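(* Let $(S,v)$ be a commutative d-monotone normed semigroup and $\phi:S\to S$ an endomorphism. Then, for every positive integer $k$, $h_{\mathfrak S}(\phi^k)=k\cdot h_{\mathfrak S}(\phi)$. Furthermore, if $\phi:S\to S$ is an automorphism, then for all $k\in\mathbb Z\setminus\{0\}$, $h_{\mathfrak S}(\phi^k)=|k|\cdot h_{\mathfrak S}(\phi)$.
   Context: A normed semigroup $(S,v)$ is a semigroup $(S,\cdot)$ with an arbitrary function $v:S\to\mathbb R_{\ge0}$ (the norm). The norm is d-monotone if $\max\{v(x),v(y)\}\le v(x\cdot y)$ for all $x,y\in S$. All homomorphisms here are in the category $\mathfrak S$ of normed semigroups and contractive semigroup homomorphisms: an endomorphism is a semigroup endomorphism $\phi$ with $v(\phi(x))\le v(x)$ for all $x$, and an automorphism is a bijective one whose inverse is also contractive (so $v(\phi(x))=v(x)$). For $x\in S$, $T_n(\phi,x)=x\cdot\phi(x)\cdots\phi^{n-1}(x)$, $h_{\mathfrak S}(\phi,x)=\limsup_{n\to\infty}\frac{v(T_n(\phi,x))}{n}$, and the semigroup entropy is $h_{\mathfrak S}(\phi)=\sup_{x\in S}h_{\mathfrak S}(\phi,x)\in[0,\infty]$. *)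

theory Defs
  imports Complex_Main "HOL-Library.Extended_Nonnegative_Real"
begin

text \<open>
  A semigroup is (the universe of) a type of class \<^class>\<open>semigroup_mult\<close>, a commutative one
  of class \<^class>\<open>ab_semigroup_mult\<close>. The norm is an arbitrary nonnegative function.
\<close>

definition normed_semigroup :: "('a::semigroup_mult \<Rightarrow> real) \<Rightarrow> bool" where
  "normed_semigroup v \<longleftrightarrow> (\<forall>x. 0 \<le> v x)"

definition d_monotone :: "('a::semigroup_mult \<Rightarrow> real) \<Rightarrow> bool" where
  "d_monotone v \<longleftrightarrow> (\<forall>x y. max (v x) (v y) \<le> v (x * y))"

definition normed_endomorphism ::
    "('a::semigroup_mult \<Rightarrow> real) \<Rightarrow> ('a \<Rightarrow> 'a) \<Rightarrow> bool" where
  "normed_endomorphism v \<phi> \<longleftrightarrow>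
     (\<forall>x y. \<phi> (x * y) = \<phi> x * \<phi> y) \<and> (\<forall>x. v (\<phi> x) \<le> v x)"

definition normed_automorphism ::
    "('a::semigroup_mult \<Rightarrow> real) \<Rightarrow> ('a \<Rightarrow> 'a) \<Rightarrow> bool" where
  "normed_automorphism v \<phi> \<longleftrightarrow>
     normed_endomorphism v \<phi> \<and> bij \<phi> \<and> (\<forall>x. v (inv \<phi> x) \<le> v x)"

text \<open>
  The trajectory \<open>T\<^sub>n(\<phi>, x) = x * \<phi> x * \<dots> * \<phi>\<^sup>n\<^sup>-\<^sup>1 x\<close> makes sense for \<open>n \<ge> 1\<close> only, as there
  need not be a unit. The value at \<open>n = 0\<close> is a dummy, which the limit superior below ignores.
\<close>

fun trajectory :: "('a::semigroup_mult \<Rightarrow> 'a) \<Rightarrow> 'a \<Rightarrow> nat \<Rightarrow> 'a" where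
  "trajectory \<phi> x 0 = x"
| "trajectory \<phi> x (Suc 0) = x"
| "trajectory \<phi> x (Suc (Suc n)) = trajectory \<phi> x (Suc n) * (\<phi> ^^ Suc n) x"

text \<open>
  Entropies take values in \<open>[0, \<infinity>]\<close>; the coercion \<^const>\<open>ennreal\<close> truncates negative reals to 0,
  which has no effect when \<open>v\<close> is a norm.
\<close>

definition entropy_at ::
    "('a::semigroup_mult \<Rightarrow> real) \<Rightarrow> ('a \<Rightarrow> 'a) \<Rightarrow> 'a \<Rightarrow> ennreal" where
  "entropy_at v \<phi> x = limsup (\<lambda>n. ennreal (v (trajectory \<phi> x n) / real n))"

definition semigroup_entropy ::
    "('a::semigroup_mult \<Rightarrow> real) \<Rightarrow> ('a \<Rightarrow> 'a) \<Rightarrow> ennreal" where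
  "semigroup_entropy v \<phi> = (SUP x. entropy_at v \<phi> x)"

text \<open>Integer powers under composition, meaningful for bijections.\<close>

definition int_funpow :: "('a \<Rightarrow> 'a) \<Rightarrow> int \<Rightarrow> 'a \<Rightarrow> 'a" where
  "int_funpow \<phi> k = (if 0 \<le> k then \<phi> ^^ nat k else inv \<phi> ^^ nat (- k))"

end

theory Submission
  imports Defs
begin

text \<open>
  Put \<open>y = T\<^sub>k(\<phi>, x)\<close>. Grouping the factors into blocks of length \<open>k\<close> gives
  \<open>T\<^sub>n(\<phi>\<^sup>k, y) = T\<^sub>n\<^sub>k(\<phi>, x)\<close>. By commutativity \<open>T\<^sub>n(\<phi>\<^sup>k, x)\<close> divides this element, so
  d-monotonicity yields \<open>h(\<phi>\<^sup>k, x) \<le> k h(\<phi>, x)\<close>; and since \<open>v (T\<^sub>m(\<phi>, x))\<close> is nondecreasing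
  in \<open>m\<close>, its growth is controlled by the multiples of \<open>k\<close>, whence \<open>k h(\<phi>, x) \<le> h(\<phi>\<^sup>k, y)\<close>.
  For an automorphism, \<open>\<phi>\<^sup>n\<^sup>-\<^sup>1\<close> maps \<open>T\<^sub>n(\<phi>\<^sup>-\<^sup>1, x)\<close> to \<open>T\<^sub>n(\<phi>, x)\<close> and preserves \<open>v\<close>, so
  \<open>\<phi>\<close> and its inverse have the same entropy.
\<close>

section \<open>Algebra of trajectories\<close>

lemma funpow_hom:
  fixes \<phi> :: "'a::semigroup_mult \<Rightarrow> 'a"
  assumes "\<And>x y. \<phi> (x * y) = \<phi> x * \<phi> y"
  shows "(\<phi> ^^ n) (x * y) = (\<phi> ^^ n) x * (\<phi> ^^ n) y"
  by (induction n) (simp_all add: assms)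

lemma trajectory_Suc:
  "0 < n \<Longrightarrow> trajectory \<phi> x (Suc n) = trajectory \<phi> x n * (\<phi> ^^ n) x"
  by (cases n) simp_all

lemma trajectory_add:
  fixes \<phi> :: "'a::semigroup_mult \<Rightarrow> 'a"
  assumes hom: "\<And>x y. \<phi> (x * y) = \<phi> x * \<phi> y" and "0 < m" "0 < n"
  shows "trajectory \<phi> x (m + n) = trajectory \<phi> x m * (\<phi> ^^ m) (trajectory \<phi> x n)"
  using \<open>0 < n\<close>
proof (induction n rule: nat_induct_non_zero)
  case 1
  then show ?case using trajectory_Suc[OF \<open>0 < m\<close>] by simp
next
  case (Suc n)
  then show ?case
    using \<open>0 < m\<close> trajectory_Suc[of "m + n" \<phi> x] trajectory_Suc[of n \<phi> x]
    by (simp add: funpow_hom[OF hom] funpow_add mult.assoc)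
qed

lemma trajectory_funpow:
  fixes \<phi> :: "'a::semigroup_mult \<Rightarrow> 'a"
  assumes hom: "\<And>x y. \<phi> (x * y) = \<phi> x * \<phi> y" and "0 < k" "0 < n"
  shows "trajectory (\<phi> ^^ k) (trajectory \<phi> x k) n = trajectory \<phi> x (n * k)"
  using \<open>0 < n\<close>
proof (induction n rule: nat_induct_non_zero)
  case 1
  then show ?case by simp
next
  case (Suc n)
  then show ?case
    using trajectory_Suc[of n "\<phi> ^^ k"] trajectory_add[OF hom, of "n * k" k x] \<open>0 < k\<close>
    by (simp add: funpow_mult mult.commute add.commute)
qed

text \<open>Commutativity sorts the factors coming from \<open>x\<close> apart from those coming
  from \<open>y\<close>. This is what isolates a divisor of a trajectory below.\<close>

lemma trajectory_mult:
  fixes \<phi> :: "'a::ab_semigroup_mult \<Rightarrow> 'a"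
  assumes hom: "\<And>x y. \<phi> (x * y) = \<phi> x * \<phi> y" and "0 < n"
  shows "trajectory \<phi> (x * y) n = trajectory \<phi> x n * trajectory \<phi> y n"
  using \<open>0 < n\<close>
proof (induction n rule: nat_induct_non_zero)
  case 1
  then show ?case by simp
next
  case (Suc n)
  then show ?case
    by (simp add: trajectory_Suc funpow_hom[OF hom] mult_ac)
qed

section \<open>Growth of the norm along trajectories\<close>

lemma d_monotoneD:
  assumes "d_monotone v"
  shows "v x \<le> v (x * y)"
  using assms by (simp add: d_monotone_def)

lemma d_monotone_trajectory_mono:
  assumes "d_monotone v" "0 < m" "m \<le> n"
  shows "v (trajectory \<phi> x m) \<le> v (trajectory \<phi> x n)"
  using \<open>m \<le> n\<close>
proof (induction n rule: dec_induct)
  case base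
  then show ?case by simp
next
  case (step n)
  then show ?case
    using d_monotoneD[OF assms(1)] trajectory_Suc[of n \<phi> x] \<open>0 < m\<close>
    by (metis less_le_trans order_trans)
qed

text \<open>Each block of length \<open>k\<close> starts with a factor of the trajectory of
  \<open>x\<close> under \<open>\<phi> ^^ k\<close>; the remaining \<open>k - 1\<close> factors of
  all blocks are collected into a cofactor, which d-monotonicity discards.\<close>

lemma d_monotone_trajectory_funpow_le:
  fixes v :: "'a::ab_semigroup_mult \<Rightarrow> real"
  assumes dm: "d_monotone v" and hom: "\<And>x y. \<phi> (x * y) = \<phi> x * \<phi> y"
    and "0 < k" "0 < n"
  shows "v (trajectory (\<phi> ^^ k) x n) \<le> v (trajectory \<phi> x (n * k))"
\<comment> \<open>For \<open>k = 1\<close> the blocks have an empty remainder, and without a unit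
  there is no cofactor to split off.\<close>
proof (cases "k = 1")
  case True
  then show ?thesis by simp
next
  case False
  with \<open>0 < k\<close> obtain j where k: "k = 1 + j" "0 < j"
    using that[of "k - 1"] by auto
  have "trajectory \<phi> x k = x * \<phi> (trajectory \<phi> x j)"
    using trajectory_add[OF hom, of 1 j x] k by simp
  then have "trajectory \<phi> x (n * k) =
      trajectory (\<phi> ^^ k) x n * trajectory (\<phi> ^^ k) (\<phi> (trajectory \<phi> x j)) n"
    unfolding trajectory_funpow[OF hom \<open>0 < k\<close> \<open>0 < n\<close>, symmetric]
    by (simp only: trajectory_mult[OF funpow_hom[OF hom] \<open>0 < n\<close>])
  then show ?thesis using d_monotoneD[OF dm] by simp
qed

section \<open>Pointwise entropy bounds and the power law\<close>

lemma Limsup_cmult_ennreal: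
  fixes c :: ennreal
  assumes "c < top" "F \<noteq> bot"
  shows "Limsup F (\<lambda>n. c * f n) = c * Limsup F f"
  using assms
  by (intro Limsup_compose_continuous_mono monoI mult_left_mono ennreal_continuous_on_cmult
      continuous_on_id) auto

lemma entropy_at_funpow_le:
  fixes v :: "'a::ab_semigroup_mult \<Rightarrow> real"
  assumes dm: "d_monotone v" and hom: "\<And>x y. \<phi> (x * y) = \<phi> x * \<phi> y" and k: "0 < k"
  shows "entropy_at v (\<phi> ^^ k) x \<le> of_nat k * entropy_at v \<phi> x"
proof -
  let ?a = "\<lambda>n. ennreal (v (trajectory \<phi> x n) / real n)"
  have "ennreal (v (trajectory (\<phi> ^^ k) x n) / real n) \<le> of_nat k * ?a (n * k)"
    if "0 < n" for n
  proof -
    \<comment> \<open>The factor \<open>k\<close> is the price of turning the denominator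
      \<open>n\<close> into the trajectory length \<open>n * k\<close>.\<close>
    have "v (trajectory (\<phi> ^^ k) x n) / real n \<le> real k * (v (trajectory \<phi> x (n * k)) / real (n * k))"
      using d_monotone_trajectory_funpow_le[OF dm hom k that, of x] that k
      by (simp add: field_simps)
    then have "ennreal (v (trajectory (\<phi> ^^ k) x n) / real n)
        \<le> ennreal (real k * (v (trajectory \<phi> x (n * k)) / real (n * k)))"
      by (rule ennreal_leI)
    then show ?thesis
      by (simp only: ennreal_mult' of_nat_0_le_iff ennreal_of_nat_eq_real_of_nat)
  qed
  then have "entropy_at v (\<phi> ^^ k) x \<le> limsup (\<lambda>n. of_nat k * ?a (n * k))"
    unfolding entropy_at_def
    by (intro Limsup_mono eventually_mono[OF eventually_gt_at_top[of 0]])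
  also have "\<dots> = of_nat k * limsup (\<lambda>n. ?a (n * k))"
    by (rule Limsup_cmult_ennreal) (simp_all add: of_nat_less_top)
  \<comment> \<open>Passing to the subsequence of multiples of \<open>k\<close> can only lower the
    limit superior.\<close>
  also have "limsup (\<lambda>n. ?a (n * k)) \<le> limsup ?a"
    using limsup_subseq_mono[of "\<lambda>n. n * k" ?a] k by (simp add: strict_mono_def o_def)
  finally show ?thesis
    by (simp add: entropy_at_def mult_left_mono)
qed

lemma entropy_at_funpow_ge:
  fixes v :: "'a::semigroup_mult \<Rightarrow> real"
  assumes dm: "d_monotone v" and hom: "\<And>x y. \<phi> (x * y) = \<phi> x * \<phi> y" and k: "0 < k"
  shows "of_nat k * entropy_at v \<phi> x \<le> entropy_at v (\<phi> ^^ k) (trajectory \<phi> x k)"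
\<comment> \<open>A bound \<open>C\<close> strictly above the limit superior holds eventually for
  the sequence itself, which makes elementary estimates possible.\<close>
proof (rule dense_ge)
  fix C assume C: "entropy_at v (\<phi> ^^ k) (trajectory \<phi> x k) < C"
  let ?a = "\<lambda>m. v (trajectory \<phi> x m) / real m"
  show "of_nat k * entropy_at v \<phi> x \<le> C"
  proof (cases C)
    case (real c)
    \<comment> \<open>\<open>m div k + 1\<close> blocks of length \<open>k\<close> cover the first
      \<open>m\<close> factors. Since this count tends to infinity, the eventual bound in the number
      of blocks becomes one in \<open>m\<close>.\<close>
    have "filterlim (\<lambda>m. m div k + 1) at_top sequentially"
      unfolding filterlim_at_top
    proof
      fix Z
      show "\<forall>\<^sub>F m in sequentially. Z \<le> m div k + 1"
        using eventually_ge_at_top[of "Z * k"]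
        by eventually_elim (use k in \<open>simp add: less_eq_div_iff_mult_less_eq le_SucI\<close>)
    qed
    moreover have "\<forall>\<^sub>F n in sequentially.
        ennreal (v (trajectory (\<phi> ^^ k) (trajectory \<phi> x k) n) / real n) < C"
      using C unfolding entropy_at_def by (rule Limsup_lessD)
    ultimately have "\<forall>\<^sub>F m in sequentially. ennreal
        (v (trajectory (\<phi> ^^ k) (trajectory \<phi> x k) (m div k + 1)) / real (m div k + 1)) < C"
      by (rule eventually_compose_filterlim[rotated])
    \<comment> \<open>The blocks overshoot \<open>m\<close> by at most \<open>k\<close> factors,
      which causes the error \<open>c * k / m\<close>; it vanishes in the limit.\<close>
    then have "\<forall>\<^sub>F m in sequentially. of_nat k * ennreal (?a m) \<le> ennreal (c + c * real k / real m)"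
      using eventually_gt_at_top[of 0]
    proof eventually_elim
      case (elim m)
      define n where "n = m div k + 1"
      have n: "0 < n" "m \<le> n * k" "n * k \<le> m + k"
        using k dividend_less_div_times[of k m] by (simp_all add: n_def)
      have "v (trajectory (\<phi> ^^ k) (trajectory \<phi> x k) n) / real n \<le> c"
        using elim(1) real unfolding n_def[symmetric]
        by (metis ennreal_le_iff less_imp_le)
      then have "v (trajectory \<phi> x (n * k)) \<le> c * real n"
        using n(1) by (simp add: trajectory_funpow[OF hom k n(1)] field_simps)
      then have "v (trajectory \<phi> x m) \<le> c * real n"
        using d_monotone_trajectory_mono[OF dm elim(2) n(2), of \<phi> x] by simp
      then have "real k * v (trajectory \<phi> x m) \<le> c * real (n * k)"
        using mult_left_mono[of _ _ "real k"] by (fastforce simp: mult_ac)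
      also have "\<dots> \<le> c * real (m + k)"
        using n(3) real by (intro mult_left_mono of_nat_mono) auto
      finally have "real k * ?a m \<le> c + c * real k / real m"
        using elim(2) by (simp add: field_simps)
      then have "ennreal (real k * ?a m) \<le> ennreal (c + c * real k / real m)"
        by (rule ennreal_leI)
      then show ?case
        by (simp only: ennreal_mult' of_nat_0_le_iff ennreal_of_nat_eq_real_of_nat)
    qed
    then have "limsup (\<lambda>m. of_nat k * ennreal (?a m))
        \<le> limsup (\<lambda>m. ennreal (c + c * real k / real m))"
      by (rule Limsup_mono)
    also have "(\<lambda>m. c + c * real k / real m) \<longlonglongrightarrow> c + 0"
      by (intro tendsto_intros lim_const_over_n)
    then have "limsup (\<lambda>m. ennreal (c + c * real k / real m)) = ennreal (c + 0)"
      by (intro lim_imp_Limsup tendsto_ennrealI) simp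
    finally show ?thesis
      using real by (simp add: entropy_at_def Limsup_cmult_ennreal of_nat_less_top)
  qed simp
qed

text \<open>The upper bound compares entropies at the same point, the lower one moves from
  \<open>x\<close> to \<open>trajectory \<phi> x k\<close>; the two are combined only after taking
  suprema.\<close>

lemma semigroup_entropy_funpow:
  fixes v :: "'a::ab_semigroup_mult \<Rightarrow> real"
  assumes dm: "d_monotone v" and hom: "\<And>x y. \<phi> (x * y) = \<phi> x * \<phi> y" and k: "0 < k"
  shows "semigroup_entropy v (\<phi> ^^ k) = of_nat k * semigroup_entropy v \<phi>"
proof (rule antisym)
  show "semigroup_entropy v (\<phi> ^^ k) \<le> of_nat k * semigroup_entropy v \<phi>"
    unfolding semigroup_entropy_def
    by (intro SUP_least order_trans[OF entropy_at_funpow_le[OF assms]] mult_left_mono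
        SUP_upper) auto
  show "of_nat k * semigroup_entropy v \<phi> \<le> semigroup_entropy v (\<phi> ^^ k)"
    unfolding semigroup_entropy_def SUP_mult_left_ennreal
    by (intro SUP_least order_trans[OF entropy_at_funpow_ge[OF assms]] SUP_upper) auto
qed

section \<open>Automorphisms and their inverses\<close>

lemma normed_automorphism_norm:
  assumes "normed_automorphism v \<phi>"
  shows "v (\<phi> x) = v x"
proof (rule antisym)
  show "v (\<phi> x) \<le> v x"
    using assms by (simp add: normed_automorphism_def normed_endomorphism_def)
  show "v x \<le> v (\<phi> x)"
    using assms unfolding normed_automorphism_def by (metis bij_is_inj inv_f_f)
qed

text \<open>Applying \<open>\<phi> ^^ n\<close> to the factors \<open>x\<close>,
  \<open>inv \<phi> x\<close>, ..., \<open>(inv \<phi> ^^ n) x\<close> yields the factors of the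
  forward trajectory in reverse order, and commutativity restores the order.\<close>

lemma funpow_trajectory_inv:
  fixes \<phi> :: "'a::ab_semigroup_mult \<Rightarrow> 'a"
  assumes hom: "\<And>x y. \<phi> (x * y) = \<phi> x * \<phi> y" and "bij \<phi>"
  shows "(\<phi> ^^ n) (trajectory (inv \<phi>) x (Suc n)) = trajectory \<phi> x (Suc n)"
proof (induction n)
  case 0
  then show ?case by simp
next
  case (Suc n)
  \<comment> \<open>The last factor of the backward trajectory becomes the first of the forward one,
    while one more \<open>\<phi>\<close> shifts the product given by the induction
    hypothesis.\<close>
  have "(\<phi> ^^ Suc n) ((inv \<phi> ^^ Suc n) x) = x"
    using \<open>bij \<phi>\<close> by (metis bij_is_surj inv_fn surj_f_inv_f surj_fn)
  then have "(\<phi> ^^ Suc n) (trajectory (inv \<phi>) x (Suc (Suc n)))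
      = \<phi> (trajectory \<phi> x (Suc n)) * x"
    using Suc by (simp add: funpow_hom[OF hom] hom del: funpow.simps) (simp add: hom)
  also have "\<dots> = trajectory \<phi> x (Suc (Suc n))"
    using trajectory_add[OF hom, of 1 "Suc n" x] by (simp add: mult.commute)
  finally show ?case .
qed

lemma entropy_at_inv:
  fixes v :: "'a::ab_semigroup_mult \<Rightarrow> real"
  assumes "normed_automorphism v \<phi>"
  shows "entropy_at v (inv \<phi>) x = entropy_at v \<phi> x"
proof -
  have hom: "\<phi> (x * y) = \<phi> x * \<phi> y" and "bij \<phi>" for x y
    using assms by (auto simp: normed_automorphism_def normed_endomorphism_def)
  have norm: "v ((\<phi> ^^ n) y) = v y" for n y
    by (induction n) (simp_all add: normed_automorphism_norm[OF assms])
  have "v (trajectory (inv \<phi>) x n) = v (trajectory \<phi> x n)" for n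
  proof (cases n)
    case (Suc m)
    then show ?thesis using funpow_trajectory_inv[OF hom \<open>bij \<phi>\<close>] norm by metis
  qed simp
  then show ?thesis by (simp add: entropy_at_def)
qed

theorem proposition3p10:
  fixes v :: "'a::ab_semigroup_mult \<Rightarrow> real" and \<phi> :: "'a \<Rightarrow> 'a"
  assumes "normed_semigroup v" and "d_monotone v" and "normed_endomorphism v \<phi>"
  shows "(\<forall>k::nat. 0 < k \<longrightarrow>
            semigroup_entropy v (\<phi> ^^ k) = of_nat k * semigroup_entropy v \<phi>) \<and>
         (normed_automorphism v \<phi> \<longrightarrow>
            (\<forall>k::int. k \<noteq> 0 \<longrightarrow>
               semigroup_entropy v (int_funpow \<phi> k) = of_nat (nat \<bar>k\<bar>) * semigroup_entropy v \<phi>))"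
proof (intro conjI allI impI)
  have hom: "\<phi> (x * y) = \<phi> x * \<phi> y" for x y
    using assms(3) by (simp add: normed_endomorphism_def)
  show pos: "semigroup_entropy v (\<phi> ^^ k) = of_nat k * semigroup_entropy v \<phi>" if "0 < k" for k
    using semigroup_entropy_funpow[OF assms(2) hom that] .
  show "semigroup_entropy v (int_funpow \<phi> k) = of_nat (nat \<bar>k\<bar>) * semigroup_entropy v \<phi>"
    if auto: "normed_automorphism v \<phi>" and "k \<noteq> 0" for k :: int
  proof (cases "0 \<le> k")
    case True
    then show ?thesis using pos[of "nat k"] \<open>k \<noteq> 0\<close> by (simp add: int_funpow_def)
  next
    case False
    have "bij \<phi>" using auto by (simp add: normed_automorphism_def)
    \<comment> \<open>Negative powers are positive powers of \<open>inv \<phi>\<close>, so the power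
      law is applied to this homomorphism before its entropy is replaced by that of
      \<open>\<phi>\<close>.\<close>
    then have "inv \<phi> (x * y) = inv \<phi> x * inv \<phi> y" for x y
      by (metis hom bij_inv_eq_iff)
    then have "semigroup_entropy v (inv \<phi> ^^ nat (- k))
        = of_nat (nat (- k)) * semigroup_entropy v (inv \<phi>)"
      using False by (intro semigroup_entropy_funpow[OF assms(2)]) auto
    then show ?thesis
      using False by (simp add: int_funpow_def semigroup_entropy_def entropy_at_inv[OF auto])
  qed
qed

end
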